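(* Let $n\ge 2$, let $v_1,v_2\in\mathbb{R}^n$ be linearly independent, let $g:\mathbb{R}^n\to\mathbb{R}$ be $g(x)=|v_1^\top x|+v_2^\top x$, and let $0<c_1<c_2<1$. Consider the BFGS method with the Armijo--Wolfe line search with parameters $c_1,c_2$, applied to $g$ from an arbitrary starting point $x_0\in\mathbb{R}^n$ and an arbitrary symmetric positive definite initial inverse Hessian approximation $H_0$, and assume that $g$ is differentiable at every iterate (including $x_0$). Then the algorithm terminates in a finite number of iterations, and at the iteration $k$ at which it terminates, $g$ is unbounded below along the search direction, i.e. $\inf_{t>0} g(x_k+tp_k)=-\infty$.
   Context: BFGS method with Armijo--Wolfe line search applied to $g$: given $x_0$ and symmetric positive definite $H_0$, at iteration $k=0,1,2,\dots$ compute the search direction $p_k=-H_k\nabla g(x_k)$; choose (any) step size $\alpha_k>0$ such that $g$ is differentiable at $x_k+\alpha_kp_k$ and the Armijo--Wolfe conditions hold: $$g(x_k+\alpha_kp_k)\le g(x_k)+c_1\alpha_k\nabla g(x_k)^\top p_k,\qquad \nabla g(x_k+\alpha_kp_k)^\top p_k\ge c_2\nabla g(x_k)^\top p_k;$$ set $x_{k+1}=x_k+\alpha_kp_k$, $s_k=x_{k+1}-x_k$, $y_k=\nabla g(x_{k+1})-\nabla g(x_k)$, $\rho_k=(s_k^\top y_k)^{-1}$ and $$H_{k+1}=(I-\rho_ks_ky_k^\top)H_k(I-\rho_ky_ks_k^\top)+\rho_ks_ks_k^\top .$$ The algorithm is said to terminate at iteration $k$ if there is no step size $\alpha_k>0$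 satisfying the Armijo--Wolfe conditions at iteration $k$. *)

theory Defs
  imports "HOL-Analysis.Analysis"
begin

(* Junk value where f is not differentiable; differentiability is therefore
   required explicitly wherever gradients are compared below. *)
definition grad :: "('a::real_inner \<Rightarrow> real) \<Rightarrow> 'a \<Rightarrow> 'a" where
  "grad f x = (THE D. GDERIV f x :> D)"

definition outer_prod :: "real^'n \<Rightarrow> real^'n \<Rightarrow> real^'n^'n" where
  "outer_prod u v = (\<chi> i j. u $ i * v $ j)"

definition sym_pos_def :: "real^'n^'n \<Rightarrow> bool" where
  "sym_pos_def A \<longleftrightarrow> transpose A = A \<and> (\<forall>x. x \<noteq> 0 \<longrightarrow> 0 < x \<bullet> (A *v x))"

(* The Wolfe condition involves the gradient at x + \<alpha> p, so an admissible step
   must lead to a point of differentiability. *)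
definition armijo_wolfe ::
  "('a::real_inner \<Rightarrow> real) \<Rightarrow> real \<Rightarrow> real \<Rightarrow> 'a \<Rightarrow> 'a \<Rightarrow> real \<Rightarrow> bool" where
  "armijo_wolfe g c1 c2 x p \<alpha> \<longleftrightarrow>
     g differentiable (at (x + \<alpha> *\<^sub>R p)) \<and>
     g (x + \<alpha> *\<^sub>R p) \<le> g x + c1 * \<alpha> * (grad g x \<bullet> p) \<and>
     grad g (x + \<alpha> *\<^sub>R p) \<bullet> p \<ge> c2 * (grad g x \<bullet> p)"

definition bfgs_direction :: "(real^'n \<Rightarrow> real) \<Rightarrow> real^'n^'n \<Rightarrow> real^'n \<Rightarrow> real^'n" where
  "bfgs_direction g H x = - (H *v grad g x)"

definition bfgs_update :: "real^'n^'n \<Rightarrow> real^'n \<Rightarrow> real^'n \<Rightarrow> real^'n^'n" where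
  "bfgs_update H s y =
     (let \<rho> = inverse (s \<bullet> y) in
       (mat 1 - \<rho> *\<^sub>R outer_prod s y) ** H ** (mat 1 - \<rho> *\<^sub>R outer_prod y s)
         + \<rho> *\<^sub>R outer_prod s s)"

definition line_search_feasible ::
  "(real^'n \<Rightarrow> real) \<Rightarrow> real \<Rightarrow> real \<Rightarrow> real^'n \<Rightarrow> real^'n^'n \<Rightarrow> bool" where
  "line_search_feasible g c1 c2 x H \<longleftrightarrow>
     (\<exists>\<alpha>>0. armijo_wolfe g c1 c2 x (bfgs_direction g H x) \<alpha>)"

(* A run may stop after finitely many iterations but is encoded by total sequences;
   the entries past the terminating iteration are unconstrained. The step sizes are
   arbitrary admissible ones. *)
definition bfgs_run ::
  "(real^'n \<Rightarrow> real) \<Rightarrow> real \<Rightarrow> real \<Rightarrow> real^'n \<Rightarrow> real^'n^'n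
    \<Rightarrow> (nat \<Rightarrow> real^'n) \<Rightarrow> (nat \<Rightarrow> real^'n^'n) \<Rightarrow> (nat \<Rightarrow> real) \<Rightarrow> bool" where
  "bfgs_run g c1 c2 x0 H0 x H \<alpha> \<longleftrightarrow>
     x 0 = x0 \<and> H 0 = H0 \<and>
     (\<forall>k. (\<forall>j\<le>k. line_search_feasible g c1 c2 (x j) (H j)) \<longrightarrow>
        \<alpha> k > 0 \<and>
        armijo_wolfe g c1 c2 (x k) (bfgs_direction g (H k) (x k)) (\<alpha> k) \<and>
        x (Suc k) = x k + \<alpha> k *\<^sub>R bfgs_direction g (H k) (x k) \<and>
        H (Suc k) = bfgs_update (H k) (x (Suc k) - x k) (grad g (x (Suc k)) - grad g (x k)))"

definition bfgs_reaches ::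
  "(real^'n \<Rightarrow> real) \<Rightarrow> real \<Rightarrow> real \<Rightarrow> (nat \<Rightarrow> real^'n) \<Rightarrow> (nat \<Rightarrow> real^'n^'n) \<Rightarrow> nat \<Rightarrow> bool"
  where
  "bfgs_reaches g c1 c2 x H k \<longleftrightarrow> (\<forall>j<k. line_search_feasible g c1 c2 (x j) (H j))"

definition bfgs_terminates_at ::
  "(real^'n \<Rightarrow> real) \<Rightarrow> real \<Rightarrow> real \<Rightarrow> (nat \<Rightarrow> real^'n) \<Rightarrow> (nat \<Rightarrow> real^'n^'n) \<Rightarrow> nat \<Rightarrow> bool"
  where
  "bfgs_terminates_at g c1 c2 x H k \<longleftrightarrow>
     bfgs_reaches g c1 c2 x H k \<and> \<not> line_search_feasible g c1 c2 (x k) (H k)"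

end

theory Submission
  imports Defs
begin

text \<open>
  Write \<open>\<tau> = \<bar>v1 \<bullet> x\<bar>\<close> for the scaled distance of an iterate from the kink, \<open>v = sgn (v1 \<bullet> x) *\<^sub>R v1\<close>,
  \<open>u = v \<bullet> (H *v (v + v2))\<close> and \<open>w = v2 \<bullet> (H *v (v + v2))\<close>. The gradient at the iterate is \<open>v + v2\<close>.
  Along the search direction \<open>g\<close> has slope \<open>- (u + w)\<close> before the kink and \<open>u - w\<close> after
  it, the kink being met at the step size \<open>\<tau> / u\<close> if \<open>u > 0\<close> and never otherwise. So the line search can
  fail only if the ray misses the kink or continues to descend behind it, and in both cases \<open>g\<close> is
  unbounded below along the ray (\<open>line_search_abs_plus_linear\<close>).

  A successful step has to change the slope, hence it crosses the kink and flips \<open>v\<close> to \<open>- v\<close>. The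
  gradient difference is then always \<open>- 2 *\<^sub>R v\<close>, and the BFGS update acts in closed form on
  the Gram matrix \<open>(a, b; b, d)\<close> of \<open>v\<close> and \<open>v2\<close> with respect to \<open>H\<close> (\<open>bfgs_update_gram\<close>).
  An infinite run would thus be an infinite orbit of a recursion in the real numbers \<open>a\<close>, \<open>b\<close>,
  \<open>d\<close>, \<open>\<tau>\<close>, which \<open>gram_recursion_not_infinite\<close> excludes.
  There, with \<open>\<lambda> = w / u\<close> and primes for the next iterate, one has \<open>- 1 < \<lambda> < 1\<close> and \<open>\<lambda> + \<lambda>' > 0\<close>,
  the latter because the Gram determinant is positive. On the other hand, with \<open>m = (1 - \<lambda>) / (1 + \<lambda>)\<close>, the quantity
  \<open>(\<lambda> + \<lambda>') * (\<alpha> * u) * m / \<tau>\<close> grows at least by the factor \<open>1 / (1 - c1)\<close> per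
  iteration, by the Armijo condition, and is at most \<open>2 * m / c1\<close>. So \<open>m\<close> exceeds 1 from some iteration on, which means
  \<open>\<lambda> < 0\<close>, and \<open>\<lambda> + \<lambda>' > 0\<close> fails.
\<close>

section \<open>The BFGS update\<close>

lemma outer_prod_mult_vec: "outer_prod u v *v q = (v \<bullet> q) *\<^sub>R u"
  by (simp add: vec_eq_iff outer_prod_def matrix_vector_mult_def inner_vec_def
      sum_distrib_left sum_distrib_right mult_ac)

lemma transpose_outer_prod: "transpose (outer_prod u v) = outer_prod v u"
  by (simp add: transpose_def outer_prod_def vec_eq_iff mult.commute)

lemma transpose_add: "transpose (A + B) = transpose A + transpose (B :: real^'n^'m)"
  by (simp add: transpose_def vec_eq_iff)

lemma transpose_diff: "transpose (A - B) = transpose A - transpose (B :: real^'n^'m)"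
  by (simp add: transpose_def vec_eq_iff)

text \<open>
  The update only has to be known through its bilinear form: the outer factors act on the two
  arguments, being adjoint to each other.
\<close>

lemma bfgs_update_inner:
  fixes H :: "real^'n^'n"
  defines "\<rho> \<equiv> \<lambda>s y. inverse (s \<bullet> y)"
  shows "p \<bullet> (bfgs_update H s y *v q) =
     (p - (\<rho> s y * (s \<bullet> p)) *\<^sub>R y) \<bullet> (H *v (q - (\<rho> s y * (s \<bullet> q)) *\<^sub>R y)) + \<rho> s y * (s \<bullet> p) * (s \<bullet> q)"
proof -
  have "bfgs_update H s y *v q =
      (let w = H *v (q - (\<rho> s y * (s \<bullet> q)) *\<^sub>R y)
       in w - (\<rho> s y * (y \<bullet> w)) *\<^sub>R s + (\<rho> s y * (s \<bullet> q)) *\<^sub>R s)"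
    by (simp add: bfgs_update_def Let_def \<rho>_def matrix_vector_mult_add_rdistrib
        matrix_vector_mult_diff_rdistrib outer_prod_mult_vec
        flip: matrix_vector_mul_assoc scaleR_matrix_vector_assoc)
  then show ?thesis
    by (simp add: Let_def inner_diff_left inner_add_right inner_diff_right inner_commute[of s p])
qed

lemma symmetric_inner_matrix_vec:
  fixes H :: "real^'n^'n"
  assumes "transpose H = H"
  shows "p \<bullet> (H *v q) = q \<bullet> (H *v p)"
  by (metis assms dot_lmul_matrix inner_commute transpose_matrix_vector)

text \<open>
  The new quadratic form at \<open>p\<close> is a sum of two nonnegative terms. They cannot vanish together: if
  the first does, then \<open>p\<close> is \<open>y\<close> times a multiple of \<open>s \<bullet> p\<close>, so \<open>s \<bullet> p\<close> is nonzero and the second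
  term is positive.
\<close>

lemma sym_pos_def_bfgs_update:
  fixes H :: "real^'n^'n"
  assumes H: "sym_pos_def H" and sy: "0 < s \<bullet> y"
  shows "sym_pos_def (bfgs_update H s y)"
proof -
  define \<rho> where "\<rho> = inverse (s \<bullet> y)"
  have \<rho>: "\<rho> > 0" "\<rho> * (s \<bullet> y) = 1" using sy by (auto simp: \<rho>_def)
  have "transpose (bfgs_update H s y) = bfgs_update H s y"
    using H by (simp add: bfgs_update_def Let_def sym_pos_def_def matrix_transpose_mul transpose_add
        transpose_diff transpose_scalar transpose_outer_prod matrix_mul_assoc)
  moreover have "0 < p \<bullet> (bfgs_update H s y *v p)" if "p \<noteq> 0" for p
  proof -
    define q where "q = p - (\<rho> * (s \<bullet> p)) *\<^sub>R y"
    have eq: "p \<bullet> (bfgs_update H s y *v p) = q \<bullet> (H *v q) + \<rho> * (s \<bullet> p)\<^sup>2"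
      by (simp add: bfgs_update_inner q_def \<rho>_def power2_eq_square)
    show ?thesis
    proof (cases "q = 0")
      case True
      then have "s \<bullet> p \<noteq> 0" using \<open>p \<noteq> 0\<close> by (auto simp: q_def)
      then show ?thesis using True \<rho> by (simp add: eq)
    next
      case False
      then have "0 < q \<bullet> (H *v q)" using H by (simp add: sym_pos_def_def)
      then show ?thesis unfolding eq using \<rho> by (smt (verit) zero_le_power2 mult_nonneg_nonneg)
    qed
  qed
  ultimately show ?thesis by (simp add: sym_pos_def_def)
qed

text \<open>
  For a step \<open>s = - \<alpha> *\<^sub>R (H *v (v + z))\<close> that turns the gradient \<open>v + z\<close> into \<open>- v + z\<close>, the
  new Gram matrix of \<open>v\<close> and \<open>z\<close> depends only on \<open>\<alpha>\<close> and the old one. The right-hand factor of the update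
  annihilates \<open>v\<close>, which is parallel to \<open>y\<close> (this is the secant equation), and sends \<open>z\<close> to
  \<open>z - ((b + d) / (a + b)) *\<^sub>R v\<close>.
\<close>

lemma bfgs_update_gram:
  fixes H :: "real^'n^'n" and v z :: "real^'n" and \<alpha> :: real
  defines "a \<equiv> v \<bullet> (H *v v)" and "b \<equiv> v \<bullet> (H *v z)" and "d \<equiv> z \<bullet> (H *v z)"
  defines "H' \<equiv> bfgs_update H (- \<alpha> *\<^sub>R (H *v (v + z))) (- 2 *\<^sub>R v)"
  assumes sym: "transpose H = H" and \<alpha>: "\<alpha> > 0" and u: "a + b > 0"
  shows "v \<bullet> (H' *v v) = \<alpha> / 2 * (a + b)"
    and "v \<bullet> (H' *v z) = \<alpha> / 2 * (b + d)"
    and "z \<bullet> (H' *v z) = (a * d - b\<^sup>2) * (a + 2 * b + d) / (a + b)\<^sup>2 + \<alpha> / 2 * (b + d)\<^sup>2 / (a + b)"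
proof -
  let ?s = "- \<alpha> *\<^sub>R (H *v (v + z))" and ?y = "- 2 *\<^sub>R v"
  have zv: "z \<bullet> (H *v v) = b" by (simp add: b_def symmetric_inner_matrix_vec[OF sym, of z])
  have sv: "?s \<bullet> v = - \<alpha> * (a + b)"
    by (simp add: a_def b_def inner_commute[of _ v] matrix_vector_right_distrib inner_add_right)
  have sz: "?s \<bullet> z = - \<alpha> * (b + d)"
    by (simp add: d_def zv inner_commute[of _ z] matrix_vector_right_distrib inner_add_right)
  have "?s \<bullet> ?y = -2 * (?s \<bullet> v)" by (simp only: inner_scaleR_right)
  then have sy: "?s \<bullet> ?y = 2 * \<alpha> * (a + b)" by (simp only: sv)
  have cancel: "inverse (2 * \<alpha> * U) * (- \<alpha> * X) = - (X / U) / 2" if "U \<noteq> 0" for U X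
    using that \<alpha> by (simp add: field_simps)
  have rv: "inverse (?s \<bullet> ?y) * (?s \<bullet> v) = - 1 / 2"
    unfolding sy sv using u by (subst cancel) auto
  have rz: "inverse (?s \<bullet> ?y) * (?s \<bullet> z) = - ((b + d) / (a + b)) / 2"
    unfolding sy sz using u by (subst cancel) auto
  have pv: "v - (- 1 / 2) *\<^sub>R ?y = 0" by simp
  have pz: "z - (- l / 2) *\<^sub>R ?y = z - l *\<^sub>R v" for l by simp
  have quad: "(z - l *\<^sub>R v) \<bullet> (H *v (z - l *\<^sub>R v)) = d - 2 * l * b + l\<^sup>2 * a" for l
    by (simp add: inner_diff_left inner_diff_right matrix_vector_mult_diff_distrib
        matrix_vector_mult_scaleR zv flip: a_def b_def d_def)
      (simp add: algebra_simps power2_eq_square)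
  show "v \<bullet> (H' *v v) = \<alpha> / 2 * (a + b)"
    unfolding H'_def bfgs_update_inner rv pv unfolding sv by simp
  show "v \<bullet> (H' *v z) = \<alpha> / 2 * (b + d)"
    unfolding H'_def bfgs_update_inner rv pv unfolding sz by simp
  have "z \<bullet> (H' *v z) = d - 2 * ((b + d) / (a + b)) * b + ((b + d) / (a + b))\<^sup>2 * a
      + \<alpha> / 2 * (b + d)\<^sup>2 / (a + b)"
    unfolding H'_def bfgs_update_inner rz pz quad unfolding sz by (simp add: power2_eq_square mult.left_commute)
  also have "d - 2 * ((b + d) / (a + b)) * b + ((b + d) / (a + b))\<^sup>2 * a
      = (a * d - b\<^sup>2) * (a + 2 * b + d) / (a + b)\<^sup>2"
  proof -
    have square: "d - 2 * (w / u) * b + (w / u)\<^sup>2 * a = (d * u\<^sup>2 - 2 * w * b * u + w\<^sup>2 * a) / u\<^sup>2"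
      if "u \<noteq> 0" for u w
      using that by (simp add: field_simps power2_eq_square)
    have expand: "d * (a + b)\<^sup>2 - 2 * (b + d) * b * (a + b) + (b + d)\<^sup>2 * a
        = (a * d - b\<^sup>2) * (a + 2 * b + d)"
      by (simp add: algebra_simps power2_eq_square)
    show ?thesis using u by (subst square) (auto simp only: expand)
  qed
  finally show "z \<bullet> (H' *v z) = (a * d - b\<^sup>2) * (a + 2 * b + d) / (a + b)\<^sup>2 + \<alpha> / 2 * (b + d)\<^sup>2 / (a + b)" .
qed

text \<open>The strict Cauchy-Schwarz inequality for the inner product given by \<open>H\<close>.\<close>

lemma sym_pos_def_gram_pos:
  fixes H :: "real^'n^'n"
  assumes H: "sym_pos_def H" and ind: "independent {v, z}" "v \<noteq> z"
  shows "(v \<bullet> (H *v z))\<^sup>2 < (v \<bullet> (H *v v)) * (z \<bullet> (H *v z))"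
proof -
  let ?a = "v \<bullet> (H *v v)" and ?b = "v \<bullet> (H *v z)" and ?d = "z \<bullet> (H *v z)"
  have "v \<noteq> 0" using ind dependent_zero by blast
  then have a: "?a > 0" using H by (simp add: sym_pos_def_def)
  have zv: "z \<bullet> (H *v v) = ?b"
    using H by (simp add: sym_pos_def_def symmetric_inner_matrix_vec[of H z])
  define q where "q = ?a *\<^sub>R z - ?b *\<^sub>R v"
  have "q \<noteq> 0"
  proof
    assume "q = 0"
    then have "?a *\<^sub>R z = ?b *\<^sub>R v" by (simp add: q_def)
    then have "(1 / ?a) *\<^sub>R (?a *\<^sub>R z) = (1 / ?a) *\<^sub>R (?b *\<^sub>R v)" by (rule arg_cong)
    then have "z = (?b / ?a) *\<^sub>R v" using a by simp
    then have "z \<in> span {v}" by (metis span_base span_scale singletonI)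
    with ind show False using dependent_def[of "{v, z}"] by (auto simp: insert_commute insert_Diff_if)
  qed
  then have "0 < q \<bullet> (H *v q)" using H by (simp add: sym_pos_def_def)
  also have "q \<bullet> (H *v q) = ?a * (?a * ?d - ?b\<^sup>2)"
    by (simp add: q_def inner_diff_left inner_diff_right matrix_vector_mult_diff_distrib
        matrix_vector_mult_scaleR zv) (simp add: algebra_simps power2_eq_square)
  finally show ?thesis using a by (simp add: zero_less_mult_iff)
qed

section \<open>The recursion for the Gram matrix\<close>

text \<open>
  The minus sign in the recursion for \<open>b\<close> comes from the flip of \<open>v\<close>, with which \<open>b\<close> is formed, at
  each step. As the step sizes are arbitrary up to the Armijo bound, the proof looks for a quantity
  that grows whatever they are. It is \<open>E\<close> below: the numerator \<open>r * (\<alpha> * u) * m\<close> at \<open>Suc k\<close> equals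
  \<open>r * (\<alpha> * u)\<close> at \<open>k\<close>, and the Armijo condition limits the overshoot \<open>\<tau> (Suc k)\<close> to
  \<open>(1 - c) * \<tau> k / m k\<close>.
\<close>

lemma gram_recursion_not_infinite:
  fixes a b d \<tau> \<alpha> :: "nat \<Rightarrow> real" and c :: real
  defines "u \<equiv> \<lambda>k. a k + b k" and "w \<equiv> \<lambda>k. b k + d k"
  assumes c: "0 < c" "c < 1"
    and apos: "\<And>k. a k > 0" and det: "\<And>k. (b k)\<^sup>2 < a k * d k"
    and S: "\<And>k. u k + w k > 0"
    and u: "\<And>k. u k > 0" and \<alpha>: "\<And>k. \<alpha> k > 0" and \<tau>: "\<And>k. \<tau> k > 0"
    and a': "\<And>k. a (Suc k) = \<alpha> k / 2 * u k"
    and b': "\<And>k. b (Suc k) = - (\<alpha> k / 2 * w k)"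
    and d': "\<And>k. d (Suc k) = (a k * d k - (b k)\<^sup>2) * (u k + w k) / (u k)\<^sup>2 + \<alpha> k / 2 * (w k)\<^sup>2 / u k"
    and \<tau>': "\<And>k. \<tau> (Suc k) = \<alpha> k * u k - \<tau> k"
    and armijo: "\<And>k. \<alpha> k * (u k - w k) + c * \<alpha> k * (u k + w k) \<le> 2 * \<tau> k"
  shows False
proof -
  have uk: "u k = a k + b k" and wk: "w k = b k + d k" for k by (simp_all add: u_def w_def)
  define D where "D k = a k * d k - (b k)\<^sup>2" for k
  define S where "S k = u k + w k" for k
  define m where "m k = (u k - w k) / S k" for k
  define r where "r k = w k / u k + w (Suc k) / u (Suc k)" for k
  define E where "E k = r k * (\<alpha> k * u k) * m k / \<tau> k" for k
  have Dpos: "D k > 0" and Spos: "S k > 0" for k using det[of k] S[of k] by (auto simp: D_def S_def)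
  have u': "u (Suc k) = \<alpha> k / 2 * (u k - w k)" for k
    unfolding uk[of "Suc k"] a' b' by (simp add: algebra_simps)
  \<comment> \<open>Positivity of the next \<open>u\<close> says that the slope behind the kink is positive, which
    is stronger than what the Wolfe condition gives for the present step.\<close>
  have wu: "w k < u k" for k using u[of "Suc k"] \<alpha>[of k] by (simp add: u' zero_less_mult_iff)
  have mpos: "m k > 0" for k using wu[of k] Spos[of k] by (simp add: m_def)
  have D': "D (Suc k) = \<alpha> k / 2 * D k * S k / u k" for k
    unfolding D_def[of "Suc k"] a' b' d' D_def[of k, symmetric] S_def[of k, symmetric]
    using u[of k] by (simp add: field_simps power2_eq_square)
  have r: "r k = D k * S k / ((u k)\<^sup>2 * u (Suc k))" for k
  proof -
    have "w (Suc k) = D k * S k / (u k)\<^sup>2 - w k / u k * u (Suc k)"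
      unfolding u' wk[of "Suc k"] b' d' D_def[of k, symmetric] S_def[of k, symmetric]
      using u[of k] by (simp add: field_simps power2_eq_square)
    then show ?thesis using u[of k] u[of "Suc k"] by (simp add: r_def field_simps)
  qed
  have rpos: "r k > 0" for k unfolding r by (intro divide_pos_pos mult_pos_pos zero_less_power Dpos Spos u)
  have r': "r (Suc k) * (\<alpha> (Suc k) * u (Suc k)) * m (Suc k) = r k * (\<alpha> k * u k)" for k
  proof -
    have "m (Suc k) = 2 * u (Suc (Suc k)) / (\<alpha> (Suc k) * S (Suc k))"
      unfolding m_def u'[of "Suc k"] using \<alpha>[of "Suc k"] by simp
    then show ?thesis
      unfolding r D' using u[of k] u[of "Suc k"] u[of "Suc (Suc k)"] \<alpha>[of "Suc k"] Spos[of k] Spos[of "Suc k"]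
      by (simp add: field_simps power2_eq_square)
  qed
  have arm: "\<alpha> k * u k * (m k + c) \<le> \<tau> k * (1 + m k)" for k
  proof -
    have "u k - w k = m k * S k" "2 * u k = (1 + m k) * S k"
      using Spos[of k] by (auto simp: m_def field_simps S_def)
    then have "\<alpha> k * u k * (m k + c) * S k = u k * (\<alpha> k * (u k - w k) + c * \<alpha> k * (u k + w k))"
      unfolding S_def[symmetric] by (simp only:) (simp add: algebra_simps)
    also have "\<dots> \<le> u k * (2 * \<tau> k)" using armijo[of k] u[of k] by simp
    also have "\<dots> = \<tau> k * (1 + m k) * S k"
      using \<open>2 * u k = (1 + m k) * S k\<close> by (simp add: algebra_simps)
    finally show ?thesis using Spos[of k] by simp
  qed
  have Epos: "E k > 0" for k using rpos[of k] \<alpha>[of k] u[of k] mpos[of k] \<tau>[of k] by (simp add: E_def)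
  have growth: "E k / (1 - c) \<le> E (Suc k)" for k
  proof -
    have "\<tau> (Suc k) * m k \<le> (1 - c) * \<tau> k - c * \<tau> (Suc k)"
    proof -
      have "\<alpha> k * u k = \<tau> k + \<tau> (Suc k)" by (simp add: \<tau>')
      then have "(\<tau> k + \<tau> (Suc k)) * (m k + c) \<le> \<tau> k * (1 + m k)" using arm[of k] by simp
      then show ?thesis by (simp add: algebra_simps)
    qed
    also have "\<dots> \<le> (1 - c) * \<tau> k" using c \<tau>[of "Suc k"] by simp
    finally have "m k / ((1 - c) * \<tau> k) \<le> 1 / \<tau> (Suc k)"
      using c \<tau>[of k] \<tau>[of "Suc k"] by (simp add: field_simps)
    then have "r k * (\<alpha> k * u k) * (m k / ((1 - c) * \<tau> k)) \<le> r k * (\<alpha> k * u k) * (1 / \<tau> (Suc k))"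
      using rpos[of k] \<alpha>[of k] u[of k] by (intro mult_left_mono) auto
    then show ?thesis unfolding E_def r' by (simp add: mult_ac)
  qed
  \<comment> \<open>\<open>r\<close> is a sum of two ratios less than 1, and \<open>\<alpha> * u / \<tau>\<close> is at most \<open>(1 + m) / (m + c)\<close>,
    hence at most \<open>1 / c\<close>.\<close>
  have bound: "E k \<le> 2 * m k / c" for k
  proof -
    have "r k < 2" using wu[of k] wu[of "Suc k"] u[of k] u[of "Suc k"]
      by (smt (verit) r_def divide_less_eq_1_pos)
    have "c * (1 + m k) \<le> m k + c" using c mpos[of k] by (simp add: algebra_simps)
    then have "\<alpha> k * u k * (c * (1 + m k)) \<le> \<alpha> k * u k * (m k + c)"
      using \<alpha>[of k] u[of k] by (intro mult_left_mono) auto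
    also note arm
    finally have "\<alpha> k * u k * c * (1 + m k) \<le> \<tau> k * (1 + m k)" by (simp add: mult_ac)
    then have "\<alpha> k * u k * c \<le> \<tau> k" using mpos[of k] by simp
    then have "\<alpha> k * u k / \<tau> k \<le> 1 / c" using \<tau>[of k] c by (simp add: field_simps)
    then have "(r k * m k) * (\<alpha> k * u k / \<tau> k) \<le> (2 * m k) * (1 / c)"
      using \<open>r k < 2\<close> rpos[of k] mpos[of k] \<alpha>[of k] u[of k] \<tau>[of k]
      by (intro mult_mono mult_right_mono) auto
    then show ?thesis by (simp add: E_def mult_ac)
  qed
  have E_ge: "E 0 * (1 / (1 - c)) ^ k \<le> E k" for k
  proof (induction k)
    case (Suc k)
    have "E 0 * (1 / (1 - c)) ^ Suc k = E 0 * (1 / (1 - c)) ^ k / (1 - c)" by simp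
    also have "\<dots> \<le> E k / (1 - c)" using Suc c by (intro divide_right_mono) auto
    finally show ?case using growth[of k] by simp
  qed simp
  have "1 / (1 - c) > 1" using c by simp
  then obtain n where n: "2 / c / E 0 < (1 / (1 - c)) ^ n" using real_arch_pow by blast
  have neg: "w k < 0" if "n \<le> k" for k
  proof -
    have "2 / c < E 0 * (1 / (1 - c)) ^ n" using n Epos[of 0] by (simp only: pos_divide_less_eq mult.commute)
    also have "\<dots> \<le> E 0 * (1 / (1 - c)) ^ k"
      using that c Epos[of 0] by (intro mult_left_mono power_increasing) auto
    also have "\<dots> \<le> 2 * m k / c" using E_ge[of k] bound[of k] by linarith
    finally have "m k > 1" using c by (simp add: field_simps)
    then show ?thesis using Spos[of k] by (simp add: m_def S_def field_simps)
  qed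
  have "r n < 0" using neg[of n] neg[of "Suc n"] u[of n] u[of "Suc n"]
    by (simp add: r_def add_neg_neg divide_neg_pos)
  with rpos[of n] show False by simp
qed

section \<open>Differentiability of the objective function\<close>

lemma grad_eqI:
  assumes "GDERIV f x :> D"
  shows "grad f x = D"
proof -
  have "D' = D" if "GDERIV f x :> D'" for D'
  proof -
    have "(\<lambda>h. h \<bullet> D') = (\<lambda>h. h \<bullet> D)"
      using that assms unfolding gderiv_def by (rule has_derivative_unique)
    then show ?thesis by (metis inner_commute vector_eq_rdot)
  qed
  with assms show ?thesis unfolding grad_def by blast
qed

lemma GDERIV_inner_left: "GDERIV (\<lambda>y. v \<bullet> y) x :> v"
  unfolding gderiv_def by (auto simp: inner_commute intro!: derivative_eq_intros)

lemma GDERIV_abs_plus_linear: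
  fixes v z x :: "'a::real_inner"
  assumes "v \<bullet> x \<noteq> 0"
  shows "GDERIV (\<lambda>y. \<bar>v \<bullet> y\<bar> + z \<bullet> y) x :> sgn (v \<bullet> x) *\<^sub>R v + z"
proof -
  have "DERIV abs (v \<bullet> x) :> sgn (v \<bullet> x)"
    using GDERIV_norm[OF assms] by simp
  from GDERIV_DERIV_compose[OF GDERIV_inner_left this] GDERIV_inner_left[of z x]
  show ?thesis by (rule GDERIV_add)
qed

text \<open>
  Adding or subtracting the identity gives a function that vanishes on one half-line, but whose
  derivative at 0 would be nonzero for one of the two choices.
\<close>

lemma not_DERIV_abs_0: "\<not> DERIV abs (0::real) :> D"
proof
  assume D: "DERIV abs (0::real) :> D"
  show False
  proof (cases "D < 1")
    case True
    have "DERIV (\<lambda>t. \<bar>t\<bar> - t) 0 :> D - 1" using D by (intro DERIV_diff DERIV_ident)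
    from DERIV_neg_dec_right[OF this] True have "\<exists>e>0. \<forall>h>0::real. \<not> h < e" by simp
    then show False using field_lbound_gt_zero by blast
  next
    case False
    have "DERIV (\<lambda>t. \<bar>t\<bar> + t) 0 :> D + 1" using D by (intro DERIV_add DERIV_ident)
    from DERIV_pos_inc_left[OF this] False have "\<exists>e>0. \<forall>h>0::real. \<not> h < e" by simp
    then show False using field_lbound_gt_zero by blast
  qed
qed

lemma differentiable_abs_plus_linear_iff:
  fixes v z x :: "'a::real_inner"
  assumes v: "v \<noteq> 0"
  shows "(\<lambda>y. \<bar>v \<bullet> y\<bar> + z \<bullet> y) differentiable (at x) \<longleftrightarrow> v \<bullet> x \<noteq> 0"
proof
  assume "v \<bullet> x \<noteq> 0"
  then show "(\<lambda>y. \<bar>v \<bullet> y\<bar> + z \<bullet> y) differentiable (at x)"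
    using GDERIV_abs_plus_linear unfolding gderiv_def differentiable_def by blast
next
  assume diff: "(\<lambda>y. \<bar>v \<bullet> y\<bar> + z \<bullet> y) differentiable (at x)"
  show "v \<bullet> x \<noteq> 0"
  proof
    assume vx: "v \<bullet> x = 0"
    \<comment> \<open>On the line through \<open>x\<close> in direction \<open>e\<close> the function is the absolute value plus an
      affine function.\<close>
    define e where "e = (1 / (v \<bullet> v)) *\<^sub>R v"
    have ve: "v \<bullet> e = 1" using v by (simp add: e_def)
    have "(\<lambda>t::real. \<bar>v \<bullet> (x + t *\<^sub>R e)\<bar> + z \<bullet> (x + t *\<^sub>R e)) differentiable (at 0)"
      by (rule differentiable_compose[where f = "\<lambda>y. \<bar>v \<bullet> y\<bar> + z \<bullet> y" and g = "\<lambda>t. x + t *\<^sub>R e"])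
        (use diff in auto)
    then have "(\<lambda>t::real. (\<bar>v \<bullet> (x + t *\<^sub>R e)\<bar> + z \<bullet> (x + t *\<^sub>R e)) - z \<bullet> (x + t *\<^sub>R e)) differentiable (at 0)"
      by (rule differentiable_diff) auto
    moreover have "(\<lambda>t::real. (\<bar>v \<bullet> (x + t *\<^sub>R e)\<bar> + z \<bullet> (x + t *\<^sub>R e)) - z \<bullet> (x + t *\<^sub>R e)) = abs"
      using vx ve by (simp add: inner_add_right fun_eq_iff)
    ultimately have "abs differentiable (at (0::real))" by simp
    then show False using not_DERIV_abs_0 by (auto simp: real_differentiable_def)
  qed
qed

section \<open>The line search\<close>

lemma INF_ereal_eq_minus_infinity:
  fixes f :: "real \<Rightarrow> real"
  assumes m: "m > 0" and f: "\<And>t. t \<ge> t0 \<Longrightarrow> f t \<le> C - m * t"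
  shows "(INF t\<in>{0<..}. ereal (f t)) = -\<infinity>"
proof -
  have "\<exists>t\<in>{0<..}. ereal (f t) < B" if "-\<infinity> < B" for B
  proof -
    obtain r where r: "ereal r < B" using ereal_dense2[OF \<open>-\<infinity> < B\<close>] by blast
    define t where "t = max 1 (max t0 ((C - r) / m))"
    have t: "t > 0" "t \<ge> t0" "t \<ge> (C - r) / m" by (auto simp: t_def)
    have "f t \<le> r" using f[OF t(2)] t(3) m by (simp add: field_simps)
    then show ?thesis using t(1) r by (intro bexI[of _ t]) (auto intro: le_less_trans[of _ "ereal r"])
  qed
  then show ?thesis using INF_eq_bot_iff[of "\<lambda>t. ereal (f t)" "{0<..}"] by (simp add: bot_ereal_def)
qed

text \<open>
  Replacing \<open>v1\<close> by \<open>- v1\<close> does not change the objective function, so \<open>v \<bullet> x > 0\<close> may be assumed.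
  Before the kink the slope is constant, and \<open>c2 < 1\<close> rules such steps out. If the slope \<open>u - w\<close>
  behind the kink is nonnegative, then the largest step size allowed by the Armijo condition lies
  behind the kink and satisfies both conditions.
\<close>

lemma line_search_abs_plus_linear:
  fixes g :: "real^'n \<Rightarrow> real" and v z x :: "real^'n" and H :: "real^'n^'n"
  assumes g_def: "g = (\<lambda>y. \<bar>v \<bullet> y\<bar> + z \<bullet> y)"
  defines "p \<equiv> bfgs_direction g H x"
    and "u \<equiv> v \<bullet> (H *v (v + z))" and "w \<equiv> z \<bullet> (H *v (v + z))"
  assumes H: "sym_pos_def H" and v: "v \<bullet> x > 0" and vz: "v + z \<noteq> 0" and c: "0 < c1" "c1 < c2" "c2 < 1"
  shows "p = - (H *v (v + z))"
    and "u + w > 0"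
    and "\<lbrakk>\<alpha> > 0; armijo_wolfe g c1 c2 x p \<alpha>\<rbrakk> \<Longrightarrow>
       \<alpha> * u > v \<bullet> x \<and> \<alpha> * (u - w) + c1 * \<alpha> * (u + w) \<le> 2 * (v \<bullet> x)"
    and "\<not> line_search_feasible g c1 c2 x H \<Longrightarrow> (INF t\<in>{0<..}. ereal (g (x + t *\<^sub>R p))) = -\<infinity>"
proof -
  have gx: "grad g x = v + z"
    using GDERIV_abs_plus_linear[of v x z] v by (intro grad_eqI) (simp add: g_def)
  show p: "p = - (H *v (v + z))" by (simp add: p_def bfgs_direction_def gx)
  have vp: "v \<bullet> p = - u" and zp: "z \<bullet> p = - w" by (simp_all add: p u_def w_def)
  have "(v + z) \<bullet> (H *v (v + z)) > 0" using H vz by (simp add: sym_pos_def_def)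
  then show S: "u + w > 0" by (simp add: u_def w_def inner_add_left)
  have v0: "v \<noteq> 0" using v by auto
  have slope: "grad g x \<bullet> p = - (u + w)" by (simp add: gx inner_add_left vp zp)
  have gt: "g (x + t *\<^sub>R p) = \<bar>v \<bullet> x - t * u\<bar> + z \<bullet> x - t * w" for t
    by (simp add: g_def inner_add_right vp zp)
  have gx0: "g x = v \<bullet> x + z \<bullet> x" using v by (simp add: g_def)
  have diff: "g differentiable (at (x + t *\<^sub>R p)) \<longleftrightarrow> t * u \<noteq> v \<bullet> x" for t
    unfolding g_def differentiable_abs_plus_linear_iff[OF v0] by (auto simp: inner_add_right vp)
  have grad_t: "grad g (x + t *\<^sub>R p) = sgn (v \<bullet> x - t * u) *\<^sub>R v + z" if "t * u \<noteq> v \<bullet> x" for t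
    using GDERIV_abs_plus_linear[of v "x + t *\<^sub>R p" z] that
    by (intro grad_eqI) (simp add: g_def inner_add_right vp)
  show "\<alpha> * u > v \<bullet> x \<and> \<alpha> * (u - w) + c1 * \<alpha> * (u + w) \<le> 2 * (v \<bullet> x)"
    if \<alpha>: "\<alpha> > 0" and aw: "armijo_wolfe g c1 c2 x p \<alpha>"
  proof -
    have ne: "\<alpha> * u \<noteq> v \<bullet> x" using aw by (simp add: armijo_wolfe_def diff)
    have cross: "\<alpha> * u > v \<bullet> x"
    proof (rule ccontr)
      assume "\<not> ?thesis"
      then have "grad g (x + \<alpha> *\<^sub>R p) = grad g x" using ne by (simp add: grad_t gx)
      then have "- (u + w) \<ge> c2 * - (u + w)" using aw by (simp add: armijo_wolfe_def slope)
      then have "(1 - c2) * (u + w) \<le> 0" by (simp add: algebra_simps)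
      with c S show False by (simp add: mult_le_0_iff)
    qed
    moreover have "g (x + \<alpha> *\<^sub>R p) \<le> g x + c1 * \<alpha> * - (u + w)"
      using aw by (simp add: armijo_wolfe_def slope)
    ultimately show ?thesis by (simp add: gt gx0 algebra_simps)
  qed
  show "(INF t\<in>{0<..}. ereal (g (x + t *\<^sub>R p))) = -\<infinity>" if inf: "\<not> line_search_feasible g c1 c2 x H"
  proof (cases "u \<le> 0")
    case True
    show ?thesis
    proof (rule INF_ereal_eq_minus_infinity[OF S])
      fix t :: real assume "t \<ge> 0"
      with True have "t * u \<le> 0" by (simp add: mult_le_0_iff)
      then show "g (x + t *\<^sub>R p) \<le> g x - (u + w) * t"
        using v by (simp add: gt gx0 algebra_simps)
    qed
  next
    case False
    then have u: "u > 0" by simp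
    have "u < w"
    proof (rule ccontr)
      assume "\<not> ?thesis"
      then have uw: "w \<le> u" by simp
      define q where "q = u - w + c1 * (u + w)"
      have q: "q > 0" using uw c S by (simp add: q_def add_nonneg_pos)
      \<comment> \<open>The step size for which the Armijo condition behind the kink holds with equality.\<close>
      define t where "t = 2 * (v \<bullet> x) / q"
      have t: "t > 0" "t * q = 2 * (v \<bullet> x)" using q v by (simp_all add: t_def)
      have "c1 * (u + w) < 1 * (u + w)" using c S by (intro mult_strict_right_mono) auto
      then have "q < 2 * u" by (simp add: q_def)
      then have "t * q < t * (2 * u)" using t(1) by (rule mult_strict_left_mono)
      then have tu: "t * u > v \<bullet> x" by (simp add: t(2))
      have "c2 * - (u + w) \<le> 0" using c S by (intro mult_nonneg_nonpos) auto
      also have "0 \<le> grad g (x + t *\<^sub>R p) \<bullet> p"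
        using tu uw by (simp add: grad_t inner_diff_left vp zp)
      finally have "armijo_wolfe g c1 c2 x p t"
        using tu t(2) by (simp add: armijo_wolfe_def diff slope gt gx0 q_def algebra_simps)
      with t(1) inf show False by (auto simp: line_search_feasible_def p_def)
    qed
    show ?thesis
    proof (rule INF_ereal_eq_minus_infinity)
      show "w - u > 0" using \<open>u < w\<close> by simp
      fix t assume "t \<ge> (v \<bullet> x) / u"
      then have "t * u \<ge> v \<bullet> x" using u by (simp add: field_simps)
      then show "g (x + t *\<^sub>R p) \<le> z \<bullet> x - v \<bullet> x - (w - u) * t"
        by (simp add: gt algebra_simps)
    qed
  qed
qed

section \<open>Finite termination\<close>

lemma independent_pair_add_neq_0:
  fixes v z :: "'a::real_vector"
  assumes "v \<noteq> z" and ind: "independent {v, z}"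
  shows "v + z \<noteq> 0" and "- v + z \<noteq> 0"
proof -
  show "- v + z \<noteq> 0" using assms(1) by simp
  show "v + z \<noteq> 0"
  proof
    assume "v + z = 0"
    then have "v = - z" by (simp add: eq_neg_iff_add_eq_0)
    then have "v \<in> span {z}" by (simp add: span_neg span_base)
    with assms show False by (auto simp: dependent_def insert_Diff_if)
  qed
qed

lemma matrix_vector_mult_minus: "(H :: real^'n^'m) *v (- v) = - (H *v v)"
  using matrix_vector_mult_scaleR[of H "-1" v] by simp

theorem mainTheorem2:
  fixes v1 v2 x0 :: "real^'n" and H0 :: "real^'n^'n"
    and g :: "real^'n \<Rightarrow> real" and c1 c2 :: real
    and x :: "nat \<Rightarrow> real^'n" and H :: "nat \<Rightarrow> real^'n^'n" and \<alpha> :: "nat \<Rightarrow> real"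
  assumes "CARD('n) \<ge> 2"
    and "v1 \<noteq> v2" and "independent {v1, v2}"
    and "g = (\<lambda>z. \<bar>v1 \<bullet> z\<bar> + v2 \<bullet> z)"
    and "0 < c1" and "c1 < c2" and "c2 < 1"
    and "sym_pos_def H0"
    and "bfgs_run g c1 c2 x0 H0 x H \<alpha>"
    and "\<forall>k. bfgs_reaches g c1 c2 x H k \<longrightarrow> g differentiable (at (x k))"
  shows "\<exists>k. bfgs_terminates_at g c1 c2 x H k \<and>
           (INF t\<in>{0<..}. ereal (g (x k + t *\<^sub>R bfgs_direction g (H k) (x k)))) = -\<infinity>"
proof -
  have v1: "v1 \<noteq> 0" using assms(3) dependent_zero by blast
  define p where "p k = bfgs_direction g (H k) (x k)" for k
  have reaches_Suc: "bfgs_reaches g c1 c2 x H (Suc k) \<longleftrightarrow>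
      bfgs_reaches g c1 c2 x H k \<and> line_search_feasible g c1 c2 (x k) (H k)" for k
    by (auto simp: bfgs_reaches_def less_Suc_eq)
  define v where "v k = sgn (v1 \<bullet> x k) *\<^sub>R v1" for k
  have g: "g = (\<lambda>y. \<bar>v k \<bullet> y\<bar> + v2 \<bullet> y)" if "v1 \<bullet> x k \<noteq> 0" for k
    using that by (simp add: assms(4) v_def abs_mult fun_eq_iff)
  have kink: "v1 \<bullet> x k \<noteq> 0" if "bfgs_reaches g c1 c2 x H k" for k
    using assms(10) that differentiable_abs_plus_linear_iff[OF v1] by (auto simp: assms(4))
  have vx: "v k \<bullet> x k = \<bar>v1 \<bullet> x k\<bar>" for k by (simp add: v_def abs_sgn mult.commute)
  have v_cases: "v k = v1 \<or> v k = - v1" if "v1 \<bullet> x k \<noteq> 0" for k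
    using that by (cases "v1 \<bullet> x k > 0") (auto simp: v_def)
  have v_add: "v k + v2 \<noteq> 0" if "v1 \<bullet> x k \<noteq> 0" for k
    using v_cases[OF that] independent_pair_add_neq_0[OF assms(2,3)] by auto
  define u where "u k = v k \<bullet> (H k *v (v k + v2))" for k
  define w where "w k = v2 \<bullet> (H k *v (v k + v2))" for k
  have step: "\<alpha> k > 0 \<and> armijo_wolfe g c1 c2 (x k) (p k) (\<alpha> k) \<and> x (Suc k) = x k + \<alpha> k *\<^sub>R p k \<and>
      H (Suc k) = bfgs_update (H k) (x (Suc k) - x k) (grad g (x (Suc k)) - grad g (x k))"
    if "bfgs_reaches g c1 c2 x H (Suc k)" for k
    using assms(9) that unfolding bfgs_run_def bfgs_reaches_def p_def by (metis less_Suc_eq_le)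
  have search: "p k = - (H k *v (v k + v2))" "u k + w k > 0"
      "\<not> line_search_feasible g c1 c2 (x k) (H k) \<Longrightarrow>
        (INF t\<in>{0<..}. ereal (g (x k + t *\<^sub>R p k))) = -\<infinity>"
      "\<lbrakk>\<alpha> k > 0; armijo_wolfe g c1 c2 (x k) (p k) (\<alpha> k)\<rbrakk> \<Longrightarrow> \<alpha> k * u k > \<bar>v1 \<bullet> x k\<bar> \<and>
        \<alpha> k * (u k - w k) + c1 * \<alpha> k * (u k + w k) \<le> 2 * \<bar>v1 \<bullet> x k\<bar>"
    if "bfgs_reaches g c1 c2 x H k" "sym_pos_def (H k)" for k
  proof -
    note ne = kink[OF that(1)]
    have "v k \<bullet> x k > 0" using ne by (simp add: vx)
    note L = line_search_abs_plus_linear[OF g[OF ne] that(2) this v_add[OF ne] assms(5-7),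
        folded u_def w_def p_def]
    show "p k = - (H k *v (v k + v2))" "u k + w k > 0"
      "\<not> line_search_feasible g c1 c2 (x k) (H k) \<Longrightarrow>
        (INF t\<in>{0<..}. ereal (g (x k + t *\<^sub>R p k))) = -\<infinity>"
      "\<lbrakk>\<alpha> k > 0; armijo_wolfe g c1 c2 (x k) (p k) (\<alpha> k)\<rbrakk> \<Longrightarrow> \<alpha> k * u k > \<bar>v1 \<bullet> x k\<bar> \<and>
        \<alpha> k * (u k - w k) + c1 * \<alpha> k * (u k + w k) \<le> 2 * \<bar>v1 \<bullet> x k\<bar>"
      using L by (simp_all add: vx)
  qed
  \<comment> \<open>Since the step crosses the kink, the gradient difference is parallel to \<open>v k\<close>; this brings the
    update into the form that \<open>bfgs_update_gram\<close> treats.\<close>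
  have cross: "v (Suc k) = - v k \<and> \<bar>v1 \<bullet> x (Suc k)\<bar> = \<alpha> k * u k - \<bar>v1 \<bullet> x k\<bar> \<and>
      H (Suc k) = bfgs_update (H k) (- \<alpha> k *\<^sub>R (H k *v (v k + v2))) (- 2 *\<^sub>R v k)"
    if r: "bfgs_reaches g c1 c2 x H (Suc k)" and pd: "sym_pos_def (H k)" for k
  proof -
    from r have r0: "bfgs_reaches g c1 c2 x H k" by (simp add: reaches_Suc)
    note st = step[OF r] and S = search[OF r0 pd]
    note ne = kink[OF r0] and ne' = kink[OF r]
    have x': "x (Suc k) = x k - \<alpha> k *\<^sub>R (H k *v (v k + v2))" using st S(1) by simp
    have vx': "v k \<bullet> x (Suc k) = \<bar>v1 \<bullet> x k\<bar> - \<alpha> k * u k"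
      by (simp add: x' inner_diff_right u_def vx)
    then have neg: "v k \<bullet> x (Suc k) < 0" using S(4) st by simp
    have flip: "v (Suc k) = - v k"
      using neg v_cases[OF ne] v_cases[OF ne'] vx[of "Suc k"] by auto
    have gr: "grad g (x j) = v j + v2" if "v1 \<bullet> x j \<noteq> 0" for j
      using GDERIV_abs_plus_linear[OF that] by (intro grad_eqI) (simp add: v_def assms(4))
    have "grad g (x (Suc k)) - grad g (x k) = - 2 *\<^sub>R v k"
      by (simp add: gr[OF ne] gr[OF ne'] flip scaleR_2)
    moreover have "x (Suc k) - x k = - \<alpha> k *\<^sub>R (H k *v (v k + v2))" by (simp add: x')
    moreover have "\<bar>v1 \<bullet> x (Suc k)\<bar> = \<alpha> k * u k - \<bar>v1 \<bullet> x k\<bar>"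
      using vx' vx[of "Suc k"] by (simp add: flip)
    ultimately show ?thesis using st flip by simp
  qed
  have pd: "sym_pos_def (H k)" if "bfgs_reaches g c1 c2 x H k" for k
    using that
  proof (induction k)
    case 0
    then show ?case using assms(8,9) by (simp add: bfgs_run_def)
  next
    case (Suc k)
    then have r0: "bfgs_reaches g c1 c2 x H k" by (simp add: reaches_Suc)
    note pd = Suc.IH[OF r0]
    have "\<alpha> k * u k > 0"
      using search(4)[OF r0 pd] step[OF Suc.prems] by (smt (verit) abs_ge_zero)
    moreover have "(- \<alpha> k *\<^sub>R (H k *v (v k + v2))) \<bullet> (- 2 *\<^sub>R v k) = 2 * (\<alpha> k * u k)"
      by (simp add: u_def inner_commute)
    ultimately have "0 < (- \<alpha> k *\<^sub>R (H k *v (v k + v2))) \<bullet> (- 2 *\<^sub>R v k)" by linarith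
    from sym_pos_def_bfgs_update[OF pd this] show ?case using cross[OF Suc.prems pd] by simp
  qed
  have "\<exists>k. bfgs_terminates_at g c1 c2 x H k"
  proof (rule ccontr)
    assume "\<not> ?thesis"
    then have "bfgs_reaches g c1 c2 x H k" for k
      by (induction k) (auto simp: reaches_Suc bfgs_terminates_at_def, simp add: bfgs_reaches_def)
    note R = this and P = pd[OF this]
    note st = step[OF R] and cr = cross[OF R P] and se = search[OF R P] and ne = kink[OF R]
    define a where "a k = v k \<bullet> (H k *v v k)" for k
    define b where "b k = v k \<bullet> (H k *v v2)" for k
    define d where "d k = v2 \<bullet> (H k *v v2)" for k
    have sym: "transpose (H k) = H k" for k using P by (simp add: sym_pos_def_def)
    have uk: "u k = a k + b k" for k
      by (simp add: u_def a_def b_def matrix_vector_right_distrib inner_add_right)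
    have wk: "w k = b k + d k" for k
      by (simp add: w_def b_def d_def matrix_vector_right_distrib inner_add_right
          symmetric_inner_matrix_vec[OF sym, where p = v2 and q = "v k" for k])
    have \<alpha>: "\<alpha> k > 0" and \<alpha>u: "\<alpha> k * u k > \<bar>v1 \<bullet> x k\<bar>"
      and arm: "\<alpha> k * (u k - w k) + c1 * \<alpha> k * (u k + w k) \<le> 2 * \<bar>v1 \<bullet> x k\<bar>" for k
      using st[of k] se(4)[of k] by auto
    have u: "u k > 0" for k
      using \<alpha>[of k] \<alpha>u[of k] by (smt (verit) abs_ge_zero zero_less_mult_pos)
    have apos: "a k > 0" for k
    proof -
      have "v k \<noteq> 0" using v_cases[OF ne, of k] v1 by auto
      then show ?thesis using P[of k] by (simp add: a_def sym_pos_def_def)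
    qed
    have det: "(b k)\<^sup>2 < a k * d k" for k
      using sym_pos_def_gram_pos[OF P assms(3,2), of k] v_cases[OF ne, of k]
      by (auto simp: a_def b_def d_def matrix_vector_mult_minus)
    note gram = bfgs_update_gram[OF sym \<alpha> u[unfolded uk a_def b_def], folded a_def b_def d_def]
    have H': "H (Suc k) = bfgs_update (H k) (- \<alpha> k *\<^sub>R (H k *v (v k + v2))) (- 2 *\<^sub>R v k)"
      and v': "v (Suc k) = - v k" for k using cr[of k] by auto
    show False
    proof (rule gram_recursion_not_infinite[where a = a and b = b and d = d and \<alpha> = \<alpha> and c = c1
          and \<tau> = "\<lambda>k. \<bar>v1 \<bullet> x k\<bar>", folded uk wk])
      show "a (Suc k) = \<alpha> k / 2 * u k" for k
        using gram(1)[of k] by (simp add: a_def[of "Suc k"] v' H' matrix_vector_mult_minus uk)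
      show "b (Suc k) = - (\<alpha> k / 2 * w k)" for k
        using gram(2)[of k] by (simp add: b_def[of "Suc k"] v' H' wk)
      show "d (Suc k) = (a k * d k - (b k)\<^sup>2) * (u k + w k) / (u k)\<^sup>2 + \<alpha> k / 2 * (w k)\<^sup>2 / u k" for k
        using gram(3)[of k] by (simp add: d_def[of "Suc k"] H' uk wk algebra_simps)
    qed (use assms(5-7) apos det se(2) u \<alpha> ne cr arm in auto)
  qed
  then obtain k where k: "bfgs_terminates_at g c1 c2 x H k" ..
  then have "bfgs_reaches g c1 c2 x H k" "\<not> line_search_feasible g c1 c2 (x k) (H k)"
    by (simp_all add: bfgs_terminates_at_def)
  with k search(3)[OF _ pd] show ?thesis unfolding p_def by blast
qed

end
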